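(* Let $\gamma:(\mathbb{R},0)\to(\mathbb{R}^4,0)$ be a curve-germ of pseudo-finite osculation type with Frenet-type frame $\{e_1,e_2,e_3,e_4\}$ and functions $l,\kappa_1,\kappa_4,\kappa_6$. Assume $\kappa_1\kappa_4\neq 0$ for all $t$, and let $$S_1(t,s,r)=\gamma(t)+\frac{l(t)}{\kappa_1(t)}e_2(t)+s\,e_3(t)+r\,e_4(t).$$ (1) $S_1$ is of cylinder type if and only if $\kappa_6\equiv 0$. (2) Suppose $\kappa_6(t)\neq 0$ for all $t$. Then $S_1$ is of cone type if and only if $f_{1cone}\equiv 0$, where $$\begin{aligned} f_{1cone}=\;&l\Big\{\kappa_1^3\kappa_4^3(\kappa_6\kappa_4'-\kappa_4\kappa_6') +\kappa_1^2\big(-\kappa_1'\kappa_4^4\kappa_6-2\kappa_1'\kappa_4'^2\kappa_6-\kappa_1'\kappa_4\kappa_4'\kappa_6'+\kappa_1'\kappa_4\kappa_4''\kappa_6\\ &\quad-\kappa_1'\kappa_4^2\kappa_6^3+2\kappa_1''\kappa_4\kappa_4'\kappa_6+\kappa_1''\kappa_4^2\kappa_6'-\kappa_1'''\kappa_4^2\kappa_6\big)\\ &\quad+\kappa_1\big(-4\kappa_1'^2\kappa_4\kappa_4'\kappa_6-2\kappa_1'^2\kappa_4^2\kappa_6'+6\kappa_1'\kappa_1''\kappa_4^2\kappa_6\big)-6\kappa_1'^3\kappa_4^2\kappa_6\Big\}\\ &+l'\kappa_1\Big\{\kappa_1^2\big(\kappa_4^4\kappa_6+\kappa_4^2\kappa_6^3+2\kappa_6\kappa_4'^2+\kappa_4\kappa_4'\kappa_6'-\kappa_4\kappa_4''\kappa_6\big)\\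 &\quad+\kappa_1\kappa_4\big(4\kappa_1'\kappa_4'\kappa_6+2\kappa_1'\kappa_4\kappa_6'-3\kappa_1''\kappa_4\kappa_6\big)+6\kappa_1'^2\kappa_4^2\kappa_6\Big\}\\ &-l''\kappa_1^2\kappa_4\Big\{\kappa_1(2\kappa_4'\kappa_6+\kappa_4\kappa_6')+3\kappa_1'\kappa_4\kappa_6\Big\} +l'''\kappa_1^3\kappa_4^2\kappa_6 . \end{aligned}$$
   Context: All maps are $C^\infty$; everything is considered for $t$ in a small open interval containing $0$; primes denote $d/dt$ and $\equiv$ means identical equality. A curve-germ $\gamma:(\mathbb{R},0)\to(\mathbb{R}^4,0)$ has pseudo-finite osculation type if the vectors $\gamma'(0),\gamma''(0),\gamma'''(0),\dots$ span a space of dimension at least $3$. Such a curve admits a Frenet-type frame: smooth unit vector fields $e_1,e_2,e_3$ and smooth functions $l,\kappa_1,\kappa_4$ with $\gamma'=l\,e_1$, $e_1'=\kappa_1e_2$, $e_2'+\kappa_1e_1=\kappa_4e_3$, and $e_4=e_1\wedge e_2\wedge e_3$ (formal determinant with first row the standard basis of $\mathbb{R}^4$, next rows $e_1,e_2,e_3$). Then $\{e_1,\dots,e_4\}$ is orthonormal and there is a function $\kappa_6$ with $e_1'=\kappa_1e_2$, $e_2'=-\kappa_1e_1+\kappa_4e_3$, $e_3'=-\kappa_4e_2+\kappa_6e_4$, $e_4'=-\kappa_6e_3$. A two-ruled hypersurface $c(t)+sX(t)+rY(t)$ is pseudo-non-degenerate if $\dim\langle X,Y,X',Y'\rangle_{\mathbb{R}}=3$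 for all $t$; this holds for $S_1$ when $\kappa_4\ne0$. Its ruling planes can be given director curves $\hat X,\hat Y$ that are constrictively adapted, i.e. $|\hat X|=|\hat Y|=1$, $\langle\hat X,\hat Y\rangle=\langle\hat X,\hat Y'\rangle=0$, with $\hat X'\neq0$; then $\hat Y'=a\hat X'$ for a function $a$. For $S_1$ one takes $\hat X=\cos\theta\,e_3-\sin\theta\,e_4$, $\hat Y=\sin\theta\,e_3+\cos\theta\,e_4$ with $\theta'=\kappa_6$ and $\cos\theta\neq0$. With $c$ the base curve ($c=\gamma+\frac{l}{\kappa_1}e_2$ for $S_1$), put $b_3=\langle c',\hat X'\rangle/\langle\hat X',\hat X'\rangle$. The striction surface is the ruled surface $\sigma_1(t,r)=\tilde c(t)+r\tilde X(t)$ with $\tilde c=c-b_3\hat X$ and $\tilde X=(-a\hat X+\hat Y)/|-a\hat X+\hat Y|$. A ruled surface $g(t,r)=\tilde c(t)+r\tilde X(t)$ with $|\tilde X|=1$ is a cylinder if $\tilde X'\equiv0$; it is non-cylindrical if $\tilde X'(t)\neq0$ for all $t$; a non-cylindrical $g$ is a cone if its striction curve $\tilde c-\frac{\langle\tilde c',\tilde X'\rangle}{\langle\tilde X',\tilde X'\rangle}\tilde X$ is constant. The hypersurface is of cylinder type (respectively cone type) if its striction surface is a cylinder (respectively a cone). *)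

theory Defs
  imports "HOL-Analysis.Analysis"
begin

section \<open>Smooth maps of one real variable\<close>

definition vd :: "(real \<Rightarrow> 'a::real_normed_vector) \<Rightarrow> real \<Rightarrow> 'a" where
  "vd f t = vector_derivative f (at t)"

text \<open>Class $C^\infty$. Only meant for open \<open>J\<close>, since derivatives are two-sided.\<close>

definition smooth_on :: "real set \<Rightarrow> (real \<Rightarrow> 'a::real_normed_vector) \<Rightarrow> bool" where
  "smooth_on J f \<longleftrightarrow> (\<forall>n. \<forall>t\<in>J. (vd ^^ n) f differentiable at t)"

section \<open>Frenet-type frames of curves in four-space\<close>

text \<open>The \<open>i\<close>-th component is the coefficient of the \<open>i\<close>-th standard basis vector in the formal
  determinant whose first row is the standard basis.\<close>

definition wedge :: "real^4 \<Rightarrow> real^4 \<Rightarrow> real^4 \<Rightarrow> real^4" where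
  "wedge x y z = (\<chi> i. det (vector [axis i 1, x, y, z] :: real^4^4))"

definition pseudo_finite_osculation_type :: "(real \<Rightarrow> real^4) \<Rightarrow> bool" where
  "pseudo_finite_osculation_type \<gamma> \<longleftrightarrow> 3 \<le> dim (span {(vd ^^ n) \<gamma> 0 | n. 1 \<le> n})"

definition frenet_type_frame ::
  "real set \<Rightarrow> (real \<Rightarrow> real^4) \<Rightarrow> (real \<Rightarrow> real^4) \<Rightarrow> (real \<Rightarrow> real^4) \<Rightarrow> (real \<Rightarrow> real^4) \<Rightarrow> (real \<Rightarrow> real^4)
    \<Rightarrow> (real \<Rightarrow> real) \<Rightarrow> (real \<Rightarrow> real) \<Rightarrow> (real \<Rightarrow> real) \<Rightarrow> (real \<Rightarrow> real) \<Rightarrow> bool" where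
  "frenet_type_frame J \<gamma> e1 e2 e3 e4 l \<kappa>1 \<kappa>4 \<kappa>6 \<longleftrightarrow>
     smooth_on J e1 \<and> smooth_on J e2 \<and> smooth_on J e3 \<and>
     smooth_on J l \<and> smooth_on J \<kappa>1 \<and> smooth_on J \<kappa>4 \<and> smooth_on J \<kappa>6 \<and>
     (\<forall>t\<in>J.
        norm (e1 t) = 1 \<and> norm (e2 t) = 1 \<and> norm (e3 t) = 1 \<and>
        e4 t = wedge (e1 t) (e2 t) (e3 t) \<and>
        vd \<gamma> t = l t *\<^sub>R e1 t \<and>
        vd e1 t = \<kappa>1 t *\<^sub>R e2 t \<and>
        vd e2 t = - \<kappa>1 t *\<^sub>R e1 t + \<kappa>4 t *\<^sub>R e3 t \<and>
        vd e3 t = - \<kappa>4 t *\<^sub>R e2 t + \<kappa>6 t *\<^sub>R e4 t \<and>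
        vd e4 t = - \<kappa>6 t *\<^sub>R e3 t)"

section \<open>Ruled surfaces\<close>

text \<open>The ruled surface $\tilde c(t) + r \tilde X(t)$ with $|\tilde X| = 1$ is given by its base
  curve \<open>ct\<close> and its unit director curve \<open>Xt\<close>.\<close>

definition is_cylinder :: "real set \<Rightarrow> (real \<Rightarrow> real^4) \<Rightarrow> (real \<Rightarrow> real^4) \<Rightarrow> bool" where
  "is_cylinder J ct Xt \<longleftrightarrow> (\<forall>t\<in>J. vd Xt t = 0)"

definition non_cylindrical :: "real set \<Rightarrow> (real \<Rightarrow> real^4) \<Rightarrow> (real \<Rightarrow> real^4) \<Rightarrow> bool" where
  "non_cylindrical J ct Xt \<longleftrightarrow> (\<forall>t\<in>J. vd Xt t \<noteq> 0)"

definition striction_curve :: "(real \<Rightarrow> real^4) \<Rightarrow> (real \<Rightarrow> real^4) \<Rightarrow> real \<Rightarrow> real^4" where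
  "striction_curve ct Xt t = ct t - ((vd ct t \<bullet> vd Xt t) / (vd Xt t \<bullet> vd Xt t)) *\<^sub>R Xt t"

definition is_cone :: "real set \<Rightarrow> (real \<Rightarrow> real^4) \<Rightarrow> (real \<Rightarrow> real^4) \<Rightarrow> bool" where
  "is_cone J ct Xt \<longleftrightarrow> non_cylindrical J ct Xt \<and> (\<exists>p. \<forall>t\<in>J. striction_curve ct Xt t = p)"

section \<open>Two-ruled hypersurfaces\<close>

definition is_two_ruled ::
  "real set \<Rightarrow> (real \<Rightarrow> real \<Rightarrow> real \<Rightarrow> real^4) \<Rightarrow> (real \<Rightarrow> real^4) \<Rightarrow> (real \<Rightarrow> real^4) \<Rightarrow> (real \<Rightarrow> real^4) \<Rightarrow> bool" where
  "is_two_ruled J S c X Y \<longleftrightarrow> smooth_on J c \<and> smooth_on J X \<and> smooth_on J Y \<and>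
     (\<forall>t\<in>J. \<forall>s r. S t s r = c t + s *\<^sub>R X t + r *\<^sub>R Y t)"

definition pseudo_nondegenerate :: "real set \<Rightarrow> (real \<Rightarrow> real^4) \<Rightarrow> (real \<Rightarrow> real^4) \<Rightarrow> bool" where
  "pseudo_nondegenerate J X Y \<longleftrightarrow> (\<forall>t\<in>J. dim (span {X t, Y t, vd X t, vd Y t}) = 3)"

definition constrictively_adapted ::
  "real set \<Rightarrow> (real \<Rightarrow> real^4) \<Rightarrow> (real \<Rightarrow> real^4) \<Rightarrow> (real \<Rightarrow> real^4) \<Rightarrow> (real \<Rightarrow> real^4) \<Rightarrow> bool" where
  "constrictively_adapted J X Y Xh Yh \<longleftrightarrow> smooth_on J Xh \<and> smooth_on J Yh \<and>
     (\<forall>t\<in>J. span {Xh t, Yh t} = span {X t, Y t} \<and>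
        norm (Xh t) = 1 \<and> norm (Yh t) = 1 \<and> Xh t \<bullet> Yh t = 0 \<and> Xh t \<bullet> vd Yh t = 0 \<and>
        vd Xh t \<noteq> 0)"

definition striction_base :: "(real \<Rightarrow> real^4) \<Rightarrow> (real \<Rightarrow> real^4) \<Rightarrow> real \<Rightarrow> real^4" where
  "striction_base c Xh t = c t - ((vd c t \<bullet> vd Xh t) / (vd Xh t \<bullet> vd Xh t)) *\<^sub>R Xh t"

definition striction_director ::
  "(real \<Rightarrow> real) \<Rightarrow> (real \<Rightarrow> real^4) \<Rightarrow> (real \<Rightarrow> real^4) \<Rightarrow> real \<Rightarrow> real^4" where
  "striction_director a Xh Yh t =
     (1 / norm (- a t *\<^sub>R Xh t + Yh t)) *\<^sub>R (- a t *\<^sub>R Xh t + Yh t)"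

text \<open>\<open>(ct, Xt)\<close> are the base and director curve of the striction surface over \<open>J\<close>. On \<open>J\<close>, the curves
  \<open>c\<close>, \<open>X\<close>, \<open>Y\<close> are determined by \<open>S\<close>, and \<open>a\<close> is determined by \<open>Xh\<close>, \<open>Yh\<close>. The adapted directors
  \<open>Xh\<close>, \<open>Yh\<close> are only unique up to a constant orthogonal change of basis of the ruling planes; such
  a change reparametrizes the rulings of the striction surface and leaves the surface itself
  unchanged. Adapted directors need not exist on all of a long interval, because the condition
  \<open>vd Xh t \<noteq> 0\<close> may fail there.\<close>

definition is_striction_surface ::
  "real set \<Rightarrow> (real \<Rightarrow> real \<Rightarrow> real \<Rightarrow> real^4) \<Rightarrow> (real \<Rightarrow> real^4) \<Rightarrow> (real \<Rightarrow> real^4) \<Rightarrow> bool" where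
  "is_striction_surface J S ct Xt \<longleftrightarrow>
     (\<exists>c X Y Xh Yh a. is_two_ruled J S c X Y \<and> pseudo_nondegenerate J X Y \<and>
        constrictively_adapted J X Y Xh Yh \<and> (\<forall>t\<in>J. vd Yh t = a t *\<^sub>R vd Xh t) \<and>
        ct = striction_base c Xh \<and> Xt = striction_director a Xh Yh)"

definition cylinder_type :: "real set \<Rightarrow> (real \<Rightarrow> real \<Rightarrow> real \<Rightarrow> real^4) \<Rightarrow> bool" where
  "cylinder_type J S \<longleftrightarrow> (\<exists>ct Xt. is_striction_surface J S ct Xt \<and> is_cylinder J ct Xt)"

definition cone_type :: "real set \<Rightarrow> (real \<Rightarrow> real \<Rightarrow> real \<Rightarrow> real^4) \<Rightarrow> bool" where
  "cone_type J S \<longleftrightarrow> (\<exists>ct Xt. is_striction_surface J S ct Xt \<and> is_cone J ct Xt)"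

definition S1 ::
  "(real \<Rightarrow> real^4) \<Rightarrow> (real \<Rightarrow> real^4) \<Rightarrow> (real \<Rightarrow> real^4) \<Rightarrow> (real \<Rightarrow> real^4) \<Rightarrow> (real \<Rightarrow> real) \<Rightarrow> (real \<Rightarrow> real)
    \<Rightarrow> real \<Rightarrow> real \<Rightarrow> real \<Rightarrow> real^4" where
  "S1 \<gamma> e2 e3 e4 l \<kappa>1 t s r = \<gamma> t + (l t / \<kappa>1 t) *\<^sub>R e2 t + s *\<^sub>R e3 t + r *\<^sub>R e4 t"

text \<open>In the body, \<open>l\<close>, \<open>k1\<close>, \<open>k4\<close>, \<open>k6\<close> are the values at \<open>t\<close>, and primes mark the values of
  derivatives at \<open>t\<close>.\<close>

definition f1cone ::
  "(real \<Rightarrow> real) \<Rightarrow> (real \<Rightarrow> real) \<Rightarrow> (real \<Rightarrow> real) \<Rightarrow> (real \<Rightarrow> real) \<Rightarrow> real \<Rightarrow> real" where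
  "f1cone fl \<kappa>1 \<kappa>4 \<kappa>6 t =
    (let l = fl t; l' = vd fl t; l'' = (vd ^^ 2) fl t; l''' = (vd ^^ 3) fl t;
         k1 = \<kappa>1 t; k1' = vd \<kappa>1 t; k1'' = (vd ^^ 2) \<kappa>1 t; k1''' = (vd ^^ 3) \<kappa>1 t;
         k4 = \<kappa>4 t; k4' = vd \<kappa>4 t; k4'' = (vd ^^ 2) \<kappa>4 t;
         k6 = \<kappa>6 t; k6' = vd \<kappa>6 t
     in l * (k1^3 * k4^3 * (k6 * k4' - k4 * k6')
           + k1^2 * (- k1' * k4^4 * k6 - 2 * k1' * k4'^2 * k6 - k1' * k4 * k4' * k6'
                     + k1' * k4 * k4'' * k6 - k1' * k4^2 * k6^3 + 2 * k1'' * k4 * k4' * k6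
                     + k1'' * k4^2 * k6' - k1''' * k4^2 * k6)
           + k1 * (- 4 * k1'^2 * k4 * k4' * k6 - 2 * k1'^2 * k4^2 * k6' + 6 * k1' * k1'' * k4^2 * k6)
           - 6 * k1'^3 * k4^2 * k6)
      + l' * k1 * (k1^2 * (k4^4 * k6 + k4^2 * k6^3 + 2 * k6 * k4'^2 + k4 * k4' * k6' - k4 * k4'' * k6)
           + k1 * k4 * (4 * k1' * k4' * k6 + 2 * k1' * k4 * k6' - 3 * k1'' * k4 * k6)
           + 6 * k1'^2 * k4^2 * k6)
      - l'' * k1^2 * k4 * (k1 * (2 * k4' * k6 + k4 * k6') + 3 * k1' * k4 * k6)
      + l''' * k1^3 * k4^2 * k6)"

end

theory Submission
  imports Defs
begin

text \<open>
  Differentiating the length conditions shows that the frame is orthonormal. For the hypersurface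
  \<open>S1\<close> this forces the shape of every adapted pair of directors: their derivatives have to be
  multiples of \<open>e2\<close>, and the director of the striction surface is \<open>e4\<close> up to a constant sign
  (\<open>adapted_directors\<close>, \<open>striction_surfaceE\<close>). Since \<open>e4' = - \<kappa>6 e3\<close>, the striction surface is a
  cylinder exactly if \<open>\<kappa>6\<close> vanishes identically, and non-cylindrical exactly if \<open>\<kappa>6\<close> has no zero.

  In the latter case put \<open>m = l / \<kappa>1\<close>, \<open>n = m' / \<kappa>4\<close> and \<open>N = (m \<kappa>4 + n') / \<kappa>6\<close>. Whatever adapted
  directors are used, the striction curve of the striction surface is
  \<open>\<gamma> + m e2 + n e3 + N e4\<close> (\<open>striction_curve_eq_apex\<close>), and its derivative is \<open>(n \<kappa>6 + N') e4\<close>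
  (\<open>apex_deriv\<close>). So it is constant exactly if \<open>n \<kappa>6 + N'\<close> vanishes identically, and clearing
  denominators turns this into the function of the theorem:
  \<open>f1cone = \<kappa>1\<^sup>4 \<kappa>4\<^sup>3 \<kappa>6\<^sup>2 (n \<kappa>6 + N')\<close> (\<open>f1cone_eq\<close>).

  Both types also require that adapted directors exist. They are found by rotating \<open>e3\<close>, \<open>e4\<close>
  through an angle \<open>\<theta>\<close> with \<open>\<theta>' = \<kappa>6\<close>, which works while \<open>cos \<theta>\<close> has no zero; with \<open>\<theta> = 0\<close> at \<open>0\<close> this
  holds near \<open>0\<close> (\<open>striction_surface_exists\<close>, \<open>local_angle\<close>).
\<close>

section \<open>Calculus of smooth maps\<close>

lemma vd_eqI: "(f has_vector_derivative D) (at t) \<Longrightarrow> vd f t = D"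
  unfolding vd_def by (rule vector_derivative_at)

lemma differentiable_iff_has_vd:
  "f differentiable at t \<longleftrightarrow> (f has_vector_derivative vd f t) (at t)"
  unfolding vd_def by (simp add: vector_derivative_works)

lemma has_vector_derivative_cong_open:
  assumes "open J" "t \<in> J" "\<And>u. u \<in> J \<Longrightarrow> f u = g u"
  shows "(f has_vector_derivative D) (at t) \<longleftrightarrow> (g has_vector_derivative D) (at t)"
proof
  show "(g has_vector_derivative D) (at t)" if "(f has_vector_derivative D) (at t)"
    using has_vector_derivative_transform_within_open[OF that assms] .
  show "(f has_vector_derivative D) (at t)" if "(g has_vector_derivative D) (at t)"
    using has_vector_derivative_transform_within_open[OF that assms(1,2)] assms(3) by metis
qed

lemma vd_cong_open:
  assumes "open J" "t \<in> J" "\<And>u. u \<in> J \<Longrightarrow> f u = g u"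
  shows "vd f t = vd g t"
  unfolding vd_def vector_derivative_def
  using has_vector_derivative_cong_open[OF assms] by simp

text \<open>Smoothness is an infinite condition, so its closure properties cannot be proved by induction
  directly: the derivative of a product is a sum of products in which only the order of
  differentiability has dropped. Counting the orders makes that drop the induction variable.\<close>

primrec diff_upto :: "real set \<Rightarrow> nat \<Rightarrow> (real \<Rightarrow> 'a::real_normed_vector) \<Rightarrow> bool" where
  "diff_upto J 0 f \<longleftrightarrow> True"
| "diff_upto J (Suc k) f \<longleftrightarrow> (\<forall>t\<in>J. f differentiable at t) \<and> diff_upto J k (vd f)"

lemma diff_upto_iff: "diff_upto J k f \<longleftrightarrow> (\<forall>n<k. \<forall>t\<in>J. (vd ^^ n) f differentiable at t)"
proof (induction k arbitrary: f)
  case (Suc k)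
  have "(\<forall>n<Suc k. \<forall>t\<in>J. (vd ^^ n) f differentiable at t) \<longleftrightarrow>
      (\<forall>t\<in>J. f differentiable at t) \<and> (\<forall>n<k. \<forall>t\<in>J. (vd ^^ n) (vd f) differentiable at t)"
    unfolding All_less_Suc2 by (simp add: funpow_Suc_right del: funpow.simps(2))
  then show ?case by (simp only: diff_upto.simps Suc.IH)
qed simp

lemma smooth_on_iff_diff_upto: "smooth_on J f \<longleftrightarrow> (\<forall>k. diff_upto J k f)"
  unfolding smooth_on_def diff_upto_iff by blast

lemma diff_upto_SucD: "diff_upto J (Suc k) f \<Longrightarrow> diff_upto J k f"
  by (simp add: diff_upto_iff)

lemma diff_upto_cong:
  assumes "open J" "\<And>t. t \<in> J \<Longrightarrow> f t = g t"
  shows "diff_upto J k f \<longleftrightarrow> diff_upto J k g"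
  using assms(2)
proof (induction k arbitrary: f g)
  case (Suc k)
  have "f differentiable at t \<longleftrightarrow> g differentiable at t" if "t \<in> J" for t
    unfolding differentiable_iff_has_vd
    using vd_cong_open[OF assms(1) that Suc.prems]
      has_vector_derivative_cong_open[OF assms(1) that Suc.prems, where D = "vd g t"] by simp
  moreover have "vd f t = vd g t" if "t \<in> J" for t
    by (rule vd_cong_open[OF assms(1) that Suc.prems])
  ultimately show ?case using Suc.IH[of "vd f" "vd g"] by simp
qed simp

text \<open>All closure proofs below go through this rule: a formula for the derivative, valid on the open
  set, may replace the derivative itself.\<close>

lemma diff_upto_SucI:
  assumes "open J" "\<And>t. t \<in> J \<Longrightarrow> (f has_vector_derivative g t) (at t)" "diff_upto J k g"
  shows "diff_upto J (Suc k) f"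
proof -
  have "diff_upto J k (vd f)"
    using assms(3) diff_upto_cong[OF assms(1), of "vd f" g] vd_eqI[OF assms(2)] by blast
  moreover have "\<forall>t\<in>J. f differentiable at t"
    using assms(2) differentiableI_vector by blast
  ultimately show ?thesis by simp
qed

lemma diff_upto_has_vd:
  "diff_upto J (Suc k) f \<Longrightarrow> t \<in> J \<Longrightarrow> (f has_vector_derivative vd f t) (at t)"
  by (simp add: differentiable_iff_has_vd)

lemma smooth_on_has_vd:
  "smooth_on J f \<Longrightarrow> t \<in> J \<Longrightarrow> (f has_vector_derivative vd f t) (at t)"
  using diff_upto_has_vd smooth_on_iff_diff_upto by blast

lemma smooth_on_vd: "smooth_on J f \<Longrightarrow> smooth_on J (vd f)"
  unfolding smooth_on_iff_diff_upto by (metis diff_upto.simps(2))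

lemma smooth_on_subset: "smooth_on J f \<Longrightarrow> K \<subseteq> J \<Longrightarrow> smooth_on K f"
  unfolding smooth_on_def by blast

lemma smooth_onI_derivative:
  assumes "open J" "\<And>t. t \<in> J \<Longrightarrow> (f has_vector_derivative g t) (at t)" "smooth_on J g"
  shows "smooth_on J f"
  unfolding smooth_on_iff_diff_upto
proof
  fix k show "diff_upto J k f"
    using diff_upto_SucI[OF assms(1,2)] assms(3) diff_upto_SucD
    unfolding smooth_on_iff_diff_upto by blast
qed

lemma diff_upto_add:
  assumes "open J" shows "diff_upto J k f \<Longrightarrow> diff_upto J k g \<Longrightarrow> diff_upto J k (\<lambda>t. f t + g t)"
proof (induction k arbitrary: f g)
  case (Suc k)
  have "((\<lambda>t. f t + g t) has_vector_derivative vd f t + vd g t) (at t)" if "t \<in> J" for t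
    using Suc.prems that by (intro has_vector_derivative_add diff_upto_has_vd)
  moreover have "diff_upto J k (\<lambda>t. vd f t + vd g t)"
    using Suc by simp
  ultimately show ?case by (rule diff_upto_SucI[OF assms])
qed simp

lemma diff_upto_scaleR:
  fixes f :: "real \<Rightarrow> real" and g :: "real \<Rightarrow> 'a::real_normed_vector"
  assumes "open J"
  shows "diff_upto J k f \<Longrightarrow> diff_upto J k g \<Longrightarrow> diff_upto J k (\<lambda>t. f t *\<^sub>R g t)"
proof (induction k arbitrary: f g)
  case (Suc k)
  have "((\<lambda>t. f t *\<^sub>R g t) has_vector_derivative f t *\<^sub>R vd g t + vd f t *\<^sub>R g t) (at t)"
    if "t \<in> J" for t
    using diff_upto_has_vd[OF Suc.prems(1) that] diff_upto_has_vd[OF Suc.prems(2) that]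
    by (intro has_vector_derivative_scaleR)
      (simp_all add: has_real_derivative_iff_has_vector_derivative)
  moreover have "diff_upto J k (\<lambda>t. f t *\<^sub>R vd g t + vd f t *\<^sub>R g t)"
    using Suc.prems(1,2)[THEN diff_upto_SucD] Suc.prems by (intro diff_upto_add[OF assms] Suc.IH) simp_all
  ultimately show ?case by (rule diff_upto_SucI[OF assms])
qed simp

lemma diff_upto_const: "open J \<Longrightarrow> diff_upto J k (\<lambda>t. c)"
proof (induction k arbitrary: c)
  case (Suc k)
  show ?case by (rule diff_upto_SucI[OF Suc.prems _ Suc.IH[OF Suc.prems, of 0]]) simp
qed simp

lemma diff_upto_mult:
  fixes f g :: "real \<Rightarrow> real"
  shows "open J \<Longrightarrow> diff_upto J k f \<Longrightarrow> diff_upto J k g \<Longrightarrow> diff_upto J k (\<lambda>t. f t * g t)"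
  using diff_upto_scaleR[of J k f g] by simp

lemma smooth_on_add: "open J \<Longrightarrow> smooth_on J f \<Longrightarrow> smooth_on J g \<Longrightarrow> smooth_on J (\<lambda>t. f t + g t)"
  by (simp add: smooth_on_iff_diff_upto diff_upto_add del: diff_upto.simps)

lemma smooth_on_scaleR:
  "open J \<Longrightarrow> smooth_on J f \<Longrightarrow> smooth_on J g \<Longrightarrow> smooth_on J (\<lambda>t. f t *\<^sub>R g t)"
  by (simp add: smooth_on_iff_diff_upto diff_upto_scaleR del: diff_upto.simps)

lemma smooth_on_const: "open J \<Longrightarrow> smooth_on J (\<lambda>t. c)"
  by (simp add: smooth_on_iff_diff_upto diff_upto_const del: diff_upto.simps)

lemma smooth_on_mult:
  fixes f g :: "real \<Rightarrow> real"
  shows "open J \<Longrightarrow> smooth_on J f \<Longrightarrow> smooth_on J g \<Longrightarrow> smooth_on J (\<lambda>t. f t * g t)"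
  using smooth_on_scaleR[of J f g] by simp

lemma smooth_on_minus:
  fixes f :: "real \<Rightarrow> 'a::real_normed_vector"
  shows "open J \<Longrightarrow> smooth_on J f \<Longrightarrow> smooth_on J (\<lambda>t. - f t)"
  using smooth_on_scaleR[of J "\<lambda>_. -1" f] smooth_on_const[of J "-1::real"] by simp

text \<open>The derivative \<open>- f' / f\<^sup>2\<close> of \<open>1 / f\<close> contains \<open>1 / f\<close> itself, one order lower, so induction on
  the order applies.\<close>

lemma smooth_on_inverse:
  fixes f :: "real \<Rightarrow> real"
  assumes J: "open J" and f: "smooth_on J f" and nz: "\<And>t. t \<in> J \<Longrightarrow> f t \<noteq> 0"
  shows "smooth_on J (\<lambda>t. inverse (f t))"
  unfolding smooth_on_iff_diff_upto
proof
  fix k show "diff_upto J k (\<lambda>t. inverse (f t))"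
  proof (induction k)
    case (Suc k)
    have "((\<lambda>t. inverse (f t)) has_vector_derivative (- 1) * (inverse (f t) * vd f t * inverse (f t))) (at t)"
      if "t \<in> J" for t
      using DERIV_inverse'[of f "vd f t" t UNIV] smooth_on_has_vd[OF f that] nz[OF that]
      by (simp add: has_real_derivative_iff_has_vector_derivative)
    moreover have "diff_upto J k (\<lambda>t. (- 1) * (inverse (f t) * vd f t * inverse (f t)))"
      using smooth_on_vd[OF f] Suc.IH
      by (intro diff_upto_mult[OF J] diff_upto_const[OF J]) (simp_all add: smooth_on_iff_diff_upto)
    ultimately show ?case by (rule diff_upto_SucI[OF J])
  qed simp
qed

lemma smooth_on_divide:
  fixes f g :: "real \<Rightarrow> real"
  assumes "open J" "smooth_on J f" "smooth_on J g" "\<And>t. t \<in> J \<Longrightarrow> g t \<noteq> 0"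
  shows "smooth_on J (\<lambda>t. f t / g t)"
  unfolding divide_inverse by (intro smooth_on_mult smooth_on_inverse assms)

text \<open>Bootstrapping for the linear system \<open>p' = k q\<close>, \<open>q' = - k p\<close>: each order of differentiability
  of the pair gives the next one. The pair \<open>cos \<theta>\<close>, \<open>- sin \<theta>\<close> with \<open>\<theta>' = k\<close> is an instance, which
  makes it smooth without a chain rule of arbitrary order.\<close>

lemma smooth_on_rotation_ode:
  fixes p q k :: "real \<Rightarrow> real"
  assumes J: "open J" and k: "smooth_on J k"
    and p: "\<And>t. t \<in> J \<Longrightarrow> (p has_vector_derivative k t * q t) (at t)"
    and q: "\<And>t. t \<in> J \<Longrightarrow> (q has_vector_derivative - (k t * p t)) (at t)"
  shows "smooth_on J p" "smooth_on J q"
proof -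
  have "diff_upto J n p \<and> diff_upto J n q" for n
  proof (induction n)
    case (Suc n)
    have "diff_upto J n (\<lambda>t. k t * q t)" "diff_upto J n (\<lambda>t. (- 1) * (k t * p t))"
      using Suc k by (intro diff_upto_mult[OF J] diff_upto_const[OF J]; simp add: smooth_on_iff_diff_upto)+
    then show ?case
      using diff_upto_SucI[OF J p] diff_upto_SucI[OF J, of q "\<lambda>t. (- 1) * (k t * p t)"] q by simp
  qed simp
  then show "smooth_on J p" "smooth_on J q" unfolding smooth_on_iff_diff_upto by auto
qed

lemma smooth_on_DERIV:
  fixes f :: "real \<Rightarrow> real"
  shows "smooth_on J f \<Longrightarrow> t \<in> J \<Longrightarrow> (f has_real_derivative vd f t) (at t)"
  by (simp add: has_real_derivative_iff_has_vector_derivative smooth_on_has_vd)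

lemma vd_eqI_DERIV_on:
  assumes "open J" "t \<in> J" "\<And>u. u \<in> J \<Longrightarrow> f u = g u" "(g has_real_derivative D) (at t)"
  shows "vd f t = D"
  using assms(4) vd_cong_open[OF assms(1-3)]
  by (simp add: has_real_derivative_iff_has_vector_derivative vd_eqI)

lemma has_vector_derivative_scaleR_vd:
  fixes f :: "real \<Rightarrow> real"
  assumes "f differentiable at t" "(g has_vector_derivative g') (at t)"
  shows "((\<lambda>u. f u *\<^sub>R g u) has_vector_derivative f t *\<^sub>R g' + vd f t *\<^sub>R g t) (at t)"
  using assms has_vector_derivative_scaleR[of f "vd f t" t UNIV g g']
  by (simp add: differentiable_iff_has_vd has_real_derivative_iff_has_vector_derivative)

lemma smooth_on_differentiable: "smooth_on J f \<Longrightarrow> t \<in> J \<Longrightarrow> f differentiable at t"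
  using smooth_on_has_vd differentiableI_vector by blast

lemma has_vector_derivative_inner:
  fixes f g :: "real \<Rightarrow> 'a::real_inner"
  assumes "(f has_vector_derivative f') (at t)" "(g has_vector_derivative g') (at t)"
  shows "((\<lambda>u. f u \<bullet> g u) has_vector_derivative f t \<bullet> g' + f' \<bullet> g t) (at t)"
  using bounded_bilinear.has_vector_derivative[OF bounded_bilinear_inner assms] .

lemma inner_constant_imp_derivative:
  fixes f g :: "real \<Rightarrow> 'a::real_inner"
  assumes "open J" "t \<in> J" "\<And>u. u \<in> J \<Longrightarrow> f u \<bullet> g u = k"
    and "(f has_vector_derivative f') (at t)" "(g has_vector_derivative g') (at t)"
  shows "f t \<bullet> g' + f' \<bullet> g t = 0"
proof -
  have "((\<lambda>u. k) has_vector_derivative f t \<bullet> g' + f' \<bullet> g t) (at t)"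
    using has_vector_derivative_inner[OF assms(4,5)]
      has_vector_derivative_cong_open[OF assms(1,2), of "\<lambda>u. f u \<bullet> g u" "\<lambda>u. k"] assms(3) by simp
  then show ?thesis
    using vector_derivative_unique_at[OF _ has_vector_derivative_const] by blast
qed

lemma differentiable_inner_curves:
  fixes f g :: "real \<Rightarrow> 'a::real_inner"
  assumes "f differentiable at t" "g differentiable at t"
  shows "(\<lambda>u. f u \<bullet> g u) differentiable at t"
  using has_vector_derivative_inner assms differentiableI_vector differentiable_iff_has_vd by blast

section \<open>The ternary cross product in four-space\<close>

lemma vector_4:
  "(vector [x, y, z, w] :: 'a::zero^4) $ 1 = x" "(vector [x, y, z, w] :: 'a^4) $ 2 = y"
  "(vector [x, y, z, w] :: 'a^4) $ 3 = z" "(vector [x, y, z, w] :: 'a^4) $ 4 = w"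
  unfolding vector_def by auto

lemma det_4:
  "det (A::'a::comm_ring_1^4^4) =
    A$1$1 * (A$2$2 * (A$3$3 * A$4$4 - A$3$4 * A$4$3) - A$2$3 * (A$3$2 * A$4$4 - A$3$4 * A$4$2)
      + A$2$4 * (A$3$2 * A$4$3 - A$3$3 * A$4$2))
  - A$1$2 * (A$2$1 * (A$3$3 * A$4$4 - A$3$4 * A$4$3) - A$2$3 * (A$3$1 * A$4$4 - A$3$4 * A$4$1)
      + A$2$4 * (A$3$1 * A$4$3 - A$3$3 * A$4$1))
  + A$1$3 * (A$2$1 * (A$3$2 * A$4$4 - A$3$4 * A$4$2) - A$2$2 * (A$3$1 * A$4$4 - A$3$4 * A$4$1)
      + A$2$4 * (A$3$1 * A$4$2 - A$3$2 * A$4$1))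
  - A$1$4 * (A$2$1 * (A$3$2 * A$4$3 - A$3$3 * A$4$2) - A$2$2 * (A$3$1 * A$4$3 - A$3$3 * A$4$1)
      + A$2$3 * (A$3$1 * A$4$2 - A$3$2 * A$4$1))"
proof -
  have f1: "finite {2::4, 3, 4}" "1 \<notin> {2::4, 3, 4}" by auto
  have f2: "finite {3::4, 4}" "2 \<notin> {3::4, 4}" by auto
  have f3: "finite {4::4}" "3 \<notin> {4::4}" by auto
  show ?thesis
    unfolding det_def UNIV_4
    unfolding sum_over_permutations_insert[OF f1]
    unfolding sum_over_permutations_insert[OF f2]
    unfolding sum_over_permutations_insert[OF f3]
    unfolding permutes_sing
    by (simp add: sign_swap_id permutation_swap_id sign_compose permutation_compose sign_id
        transpose_eq_iff swap_id_eq algebra_simps)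
qed

lemma wedge_components:
  "wedge x y z $ 1 = x$2 * (y$3 * z$4 - y$4 * z$3) - x$3 * (y$2 * z$4 - y$4 * z$2) + x$4 * (y$2 * z$3 - y$3 * z$2)"
  "wedge x y z $ 2 = - (x$1 * (y$3 * z$4 - y$4 * z$3) - x$3 * (y$1 * z$4 - y$4 * z$1) + x$4 * (y$1 * z$3 - y$3 * z$1))"
  "wedge x y z $ 3 = x$1 * (y$2 * z$4 - y$4 * z$2) - x$2 * (y$1 * z$4 - y$4 * z$1) + x$4 * (y$1 * z$2 - y$2 * z$1)"
  "wedge x y z $ 4 = - (x$1 * (y$2 * z$3 - y$3 * z$2) - x$2 * (y$1 * z$3 - y$3 * z$1) + x$3 * (y$1 * z$2 - y$2 * z$1))"
  unfolding wedge_def by (simp_all add: det_4 vector_4 axis_def)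

lemma inner_4: "(x::real^4) \<bullet> y = x$1 * y$1 + x$2 * y$2 + x$3 * y$3 + x$4 * y$4"
  by (simp add: inner_vec_def sum_4)

lemma inner_wedge: "wedge x y z \<bullet> x = 0" "wedge x y z \<bullet> y = 0" "wedge x y z \<bullet> z = 0"
  unfolding inner_4 wedge_components by algebra+

text \<open>The squared length of the cross product is the Gram determinant of its factors, so \<open>wedge\<close> maps
  orthonormal triples to unit vectors.\<close>

lemma wedge_gram:
  "wedge x y z \<bullet> wedge x y z =
    (x \<bullet> x) * ((y \<bullet> y) * (z \<bullet> z) - (y \<bullet> z)\<^sup>2) - (x \<bullet> y) * ((x \<bullet> y) * (z \<bullet> z) - (y \<bullet> z) * (x \<bullet> z))
    + (x \<bullet> z) * ((x \<bullet> y) * (y \<bullet> z) - (y \<bullet> y) * (x \<bullet> z))"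
  unfolding inner_4 wedge_components by algebra

lemma differentiable_vec_nth: 
  fixes f :: "real \<Rightarrow> real^4"
  shows "f differentiable at t \<Longrightarrow> (\<lambda>u. f u $ i) differentiable at t"
  unfolding differentiable_def using bounded_linear.has_derivative[OF bounded_linear_vec_nth] by blast

lemma differentiable_wedge:
  fixes f g h :: "real \<Rightarrow> real^4"
  assumes "f differentiable at t" "g differentiable at t" "h differentiable at t"
  shows "(\<lambda>u. wedge (f u) (g u) (h u)) differentiable at t"
proof -
  have "(\<lambda>u. wedge (f u) (g u) (h u) $ i) differentiable at t" for i
    using exhaust_4[of i] by (auto simp: wedge_components assms differentiable_vec_nth)
  then show ?thesis
    unfolding differentiable_componentwise_within[of "\<lambda>u. wedge (f u) (g u) (h u)"]
    by (auto simp: Basis_vec_def inner_axis)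
qed

section \<open>Hypersurfaces swept out by the normal planes of a Frenet-type frame\<close>

locale frenet_frame =
  fixes J :: "real set" and \<gamma> e1 e2 e3 e4 :: "real \<Rightarrow> real^4" and l \<kappa>1 \<kappa>4 \<kappa>6 :: "real \<Rightarrow> real"
  assumes open_J: "open J" and interval_J: "is_interval J"
    and smooth_\<gamma>: "smooth_on J \<gamma>"
    and frame: "frenet_type_frame J \<gamma> e1 e2 e3 e4 l \<kappa>1 \<kappa>4 \<kappa>6"
    and \<kappa>1_\<kappa>4_nz: "\<And>t. t \<in> J \<Longrightarrow> \<kappa>1 t * \<kappa>4 t \<noteq> 0"
begin

lemma \<kappa>1_nz: "t \<in> J \<Longrightarrow> \<kappa>1 t \<noteq> 0" and \<kappa>4_nz: "t \<in> J \<Longrightarrow> \<kappa>4 t \<noteq> 0"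
  using \<kappa>1_\<kappa>4_nz by auto

lemma frame_smooth:
  "smooth_on J e1" "smooth_on J e2" "smooth_on J e3"
  "smooth_on J l" "smooth_on J \<kappa>1" "smooth_on J \<kappa>4" "smooth_on J \<kappa>6"
  using frame unfolding frenet_type_frame_def by auto

lemma \<gamma>_deriv: "t \<in> J \<Longrightarrow> (\<gamma> has_vector_derivative l t *\<^sub>R e1 t) (at t)"
  and e1_deriv: "t \<in> J \<Longrightarrow> (e1 has_vector_derivative \<kappa>1 t *\<^sub>R e2 t) (at t)"
  and e2_deriv: "t \<in> J \<Longrightarrow> (e2 has_vector_derivative - \<kappa>1 t *\<^sub>R e1 t + \<kappa>4 t *\<^sub>R e3 t) (at t)"
  and e3_deriv: "t \<in> J \<Longrightarrow> (e3 has_vector_derivative - \<kappa>4 t *\<^sub>R e2 t + \<kappa>6 t *\<^sub>R e4 t) (at t)"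
  using smooth_on_has_vd[OF smooth_\<gamma>, of t] frame_smooth(1-3)[THEN smooth_on_has_vd, of t] frame
  unfolding frenet_type_frame_def by auto

text \<open>The frame equations prescribe the value of \<open>vd e4\<close>, which says something about \<open>e4\<close> only once \<open>e4\<close>
  is differentiable; that comes from its being a cross product of differentiable curves.\<close>

lemma e4_deriv:
  assumes "t \<in> J" shows "(e4 has_vector_derivative - \<kappa>6 t *\<^sub>R e3 t) (at t)"
proof -
  have "(\<lambda>u. wedge (e1 u) (e2 u) (e3 u)) differentiable at t"
    using assms by (intro differentiable_wedge differentiableI_vector[OF e1_deriv]
        differentiableI_vector[OF e2_deriv] differentiableI_vector[OF e3_deriv])
  then obtain D where "((\<lambda>u. wedge (e1 u) (e2 u) (e3 u)) has_vector_derivative D) (at t)"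
    using differentiable_iff_has_vd by blast
  then have "(e4 has_vector_derivative D) (at t)"
    using has_vector_derivative_cong_open[OF open_J assms, of e4 "\<lambda>u. wedge (e1 u) (e2 u) (e3 u)"]
      frame unfolding frenet_type_frame_def by simp
  moreover have "vd e4 t = - \<kappa>6 t *\<^sub>R e3 t"
    using frame assms unfolding frenet_type_frame_def by simp
  ultimately show ?thesis using vd_eqI by metis
qed

lemma smooth_e4: "smooth_on J e4"
  using smooth_onI_derivative[OF open_J e4_deriv] smooth_on_scaleR[OF open_J smooth_on_minus[OF open_J frame_smooth(7)] frame_smooth(3)]
  by simp

lemma frame_norm:
  "t \<in> J \<Longrightarrow> e1 t \<bullet> e1 t = 1" "t \<in> J \<Longrightarrow> e2 t \<bullet> e2 t = 1" "t \<in> J \<Longrightarrow> e3 t \<bullet> e3 t = 1"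
  using frame unfolding frenet_type_frame_def by (auto simp: dot_square_norm)

text \<open>Differentiate \<open>|e1| = 1\<close>, then \<open>|e2| = 1\<close>, then \<open>e1 \<bullet> e2 = 0\<close>, and divide by the nonzero curvatures.\<close>

lemma frame_orthogonal:
  assumes "t \<in> J" shows "e1 t \<bullet> e2 t = 0" "e2 t \<bullet> e3 t = 0" "e1 t \<bullet> e3 t = 0"
proof -
  have 12: "e1 u \<bullet> e2 u = 0" if u: "u \<in> J" for u
    using inner_constant_imp_derivative[OF open_J u frame_norm(1) e1_deriv[OF u] e1_deriv[OF u]]
      \<kappa>1_nz[OF u] by (simp add: inner_commute)
  then show "e1 t \<bullet> e2 t = 0" using assms .
  show "e2 t \<bullet> e3 t = 0"
    using inner_constant_imp_derivative[OF open_J assms frame_norm(2) e2_deriv[OF assms] e2_deriv[OF assms]]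
      \<kappa>4_nz[OF assms] 12[OF assms] by (simp add: inner_commute inner_simps)
  show "e1 t \<bullet> e3 t = 0"
    using inner_constant_imp_derivative[OF open_J assms 12 e1_deriv[OF assms] e2_deriv[OF assms]]
      \<kappa>4_nz[OF assms] frame_norm[OF assms] by (simp add: inner_commute inner_simps)
qed

lemma frame_inner:
  assumes "t \<in> J"
  shows "e1 t \<bullet> e1 t = 1" "e1 t \<bullet> e2 t = 0" "e1 t \<bullet> e3 t = 0" "e1 t \<bullet> e4 t = 0"
    "e2 t \<bullet> e1 t = 0" "e2 t \<bullet> e2 t = 1" "e2 t \<bullet> e3 t = 0" "e2 t \<bullet> e4 t = 0"
    "e3 t \<bullet> e1 t = 0" "e3 t \<bullet> e2 t = 0" "e3 t \<bullet> e3 t = 1" "e3 t \<bullet> e4 t = 0"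
    "e4 t \<bullet> e1 t = 0" "e4 t \<bullet> e2 t = 0" "e4 t \<bullet> e3 t = 0" "e4 t \<bullet> e4 t = 1"
proof -
  have e4: "e4 t = wedge (e1 t) (e2 t) (e3 t)"
    using frame assms unfolding frenet_type_frame_def by simp
  note o = frame_norm[OF assms] frame_orthogonal[OF assms]
  show "e4 t \<bullet> e4 t = 1" unfolding e4 wedge_gram o by simp
  show "e4 t \<bullet> e1 t = 0" "e4 t \<bullet> e2 t = 0" "e4 t \<bullet> e3 t = 0" unfolding e4 by (rule inner_wedge)+
  then show "e1 t \<bullet> e4 t = 0" "e2 t \<bullet> e4 t = 0" "e3 t \<bullet> e4 t = 0"
    by (simp_all add: inner_commute)
qed (use assms in \<open>simp_all add: frame_norm frame_orthogonal inner_commute\<close>)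

text \<open>\<open>base\<close> is the base curve of \<open>S1\<close>. Relative to it, \<open>n\<close> and \<open>N\<close> are the coordinates, in the ruling
  plane spanned by \<open>e3\<close> and \<open>e4\<close>, of the point \<open>apex\<close> that the
  striction curve of the striction surface passes through where \<open>\<kappa>6\<close> does not vanish.\<close>

definition m :: "real \<Rightarrow> real" where "m t = l t / \<kappa>1 t"
definition n :: "real \<Rightarrow> real" where "n t = vd m t / \<kappa>4 t"
definition N :: "real \<Rightarrow> real" where "N t = (m t * \<kappa>4 t + vd n t) / \<kappa>6 t"
definition base :: "real \<Rightarrow> real^4" where "base t = \<gamma> t + m t *\<^sub>R e2 t"
definition apex :: "real \<Rightarrow> real^4" where "apex t = base t + n t *\<^sub>R e3 t + N t *\<^sub>R e4 t"

abbreviation "S \<equiv> S1 \<gamma> e2 e3 e4 l \<kappa>1"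

lemma smooth_m: "smooth_on J m"
  unfolding m_def[abs_def] by (intro smooth_on_divide open_J frame_smooth \<kappa>1_nz)

lemma smooth_n: "smooth_on J n"
  unfolding n_def[abs_def] by (intro smooth_on_divide open_J frame_smooth smooth_on_vd smooth_m \<kappa>4_nz)

lemma smooth_N: "(\<And>t. t \<in> J \<Longrightarrow> \<kappa>6 t \<noteq> 0) \<Longrightarrow> smooth_on J N"
  unfolding N_def[abs_def]
  by (intro smooth_on_divide smooth_on_add smooth_on_mult open_J frame_smooth smooth_on_vd smooth_m smooth_n)

lemma smooth_base: "smooth_on J base"
  unfolding base_def[abs_def]
  by (intro smooth_on_add smooth_on_scaleR open_J smooth_\<gamma> smooth_m frame_smooth)

text \<open>The coefficient \<open>m = l / \<kappa>1\<close> is chosen so that the component along \<open>e1\<close> cancels.\<close>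

lemma base_deriv:
  assumes "t \<in> J" shows "(base has_vector_derivative vd m t *\<^sub>R e2 t + (m t * \<kappa>4 t) *\<^sub>R e3 t) (at t)"
proof -
  have *: "(base has_vector_derivative l t *\<^sub>R e1 t +
      (m t *\<^sub>R (- \<kappa>1 t *\<^sub>R e1 t + \<kappa>4 t *\<^sub>R e3 t) + vd m t *\<^sub>R e2 t)) (at t)"
    unfolding base_def[abs_def] using assms
    by (intro has_vector_derivative_add \<gamma>_deriv has_vector_derivative_scaleR_vd e2_deriv smooth_on_differentiable[OF smooth_m])
  have "l t = m t * \<kappa>1 t" using \<kappa>1_nz[OF assms] by (simp add: m_def)
  then show ?thesis by (intro has_vector_derivative_eq_rhs[OF *]) (simp add: algebra_simps)
qed

lemma plane_curve_deriv:
  assumes t: "t \<in> J" and pq: "p differentiable at t" "q differentiable at t"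
    and f: "\<And>u. u \<in> J \<Longrightarrow> f u = p u *\<^sub>R e3 u + q u *\<^sub>R e4 u"
  shows "(f has_vector_derivative
      (- p t * \<kappa>4 t) *\<^sub>R e2 t + (vd p t - q t * \<kappa>6 t) *\<^sub>R e3 t + (vd q t + p t * \<kappa>6 t) *\<^sub>R e4 t) (at t)"
proof -
  have *: "((\<lambda>u. p u *\<^sub>R e3 u + q u *\<^sub>R e4 u) has_vector_derivative
      (p t *\<^sub>R (- \<kappa>4 t *\<^sub>R e2 t + \<kappa>6 t *\<^sub>R e4 t) + vd p t *\<^sub>R e3 t) +
      (q t *\<^sub>R (- \<kappa>6 t *\<^sub>R e3 t) + vd q t *\<^sub>R e4 t)) (at t)"
    using t by (intro has_vector_derivative_add has_vector_derivative_scaleR_vd e3_deriv e4_deriv pq)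
  have "((\<lambda>u. p u *\<^sub>R e3 u + q u *\<^sub>R e4 u) has_vector_derivative
      (- p t * \<kappa>4 t) *\<^sub>R e2 t + (vd p t - q t * \<kappa>6 t) *\<^sub>R e3 t + (vd q t + p t * \<kappa>6 t) *\<^sub>R e4 t) (at t)"
    by (intro has_vector_derivative_eq_rhs[OF *]) (simp add: algebra_simps)
  then show ?thesis
    by (rule has_vector_derivative_cong_open[OF open_J t f, THEN iffD2, rotated])
qed

text \<open>Written with quotients this identity is hard to handle. Instead, every derivative is expressed
  polynomially through the relations \<open>l = m \<kappa>1\<close>, \<open>m' = n \<kappa>4\<close>, \<open>n' = N \<kappa>6 - m \<kappa>4\<close> and what they give on
  differentiation. After substitution both sides are polynomials in \<open>m\<close>, \<open>n\<close>, \<open>N\<close>, \<open>N'\<close> and the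
  derivatives of the curvatures, and they agree identically.\<close>

lemma f1cone_eq:
  assumes t: "t \<in> J" and k6: "\<And>t. t \<in> J \<Longrightarrow> \<kappa>6 t \<noteq> 0"
  shows "f1cone l \<kappa>1 \<kappa>4 \<kappa>6 t = \<kappa>1 t ^ 4 * \<kappa>4 t ^ 3 * \<kappa>6 t ^ 2 * (n t * \<kappa>6 t + vd N t)"
proof -
  have "smooth_on J N" using smooth_N k6 by blast
  note sm = frame_smooth(5-7) smooth_m smooth_n this
  note sm' = sm sm[THEN smooth_on_vd] sm[THEN smooth_on_vd, THEN smooth_on_vd]
  note D = sm'[THEN smooth_on_DERIV]
  note diff = vd_eqI_DERIV_on[OF open_J]
  have l0: "l u = m u * \<kappa>1 u" if "u \<in> J" for u
    using \<kappa>1_nz[OF that] by (simp add: m_def)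
  have l1: "vd l u = vd m u * \<kappa>1 u + m u * vd \<kappa>1 u" if u: "u \<in> J" for u
    by (rule diff[OF u l0]) (auto intro!: derivative_eq_intros D[OF u] simp: algebra_simps)
  have l2: "vd (vd l) u = vd (vd m) u * \<kappa>1 u + 2 * vd m u * vd \<kappa>1 u + m u * vd (vd \<kappa>1) u"
    if u: "u \<in> J" for u
    by (rule diff[OF u l1]) (auto intro!: derivative_eq_intros D[OF u] simp: algebra_simps)
  have l3: "vd (vd (vd l)) u = vd (vd (vd m)) u * \<kappa>1 u + 3 * vd (vd m) u * vd \<kappa>1 u
      + 3 * vd m u * vd (vd \<kappa>1) u + m u * vd (vd (vd \<kappa>1)) u" if u: "u \<in> J" for u
    by (rule diff[OF u l2]) (auto intro!: derivative_eq_intros D[OF u] simp: algebra_simps)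
  have m1: "vd m u = n u * \<kappa>4 u" if "u \<in> J" for u
    using \<kappa>4_nz[OF that] by (simp add: n_def)
  have m2: "vd (vd m) u = vd n u * \<kappa>4 u + n u * vd \<kappa>4 u" if u: "u \<in> J" for u
    by (rule diff[OF u m1]) (auto intro!: derivative_eq_intros D[OF u] simp: algebra_simps)
  have m3: "vd (vd (vd m)) u = vd (vd n) u * \<kappa>4 u + 2 * vd n u * vd \<kappa>4 u + n u * vd (vd \<kappa>4) u"
    if u: "u \<in> J" for u
    by (rule diff[OF u m2]) (auto intro!: derivative_eq_intros D[OF u] simp: algebra_simps)
  have n1: "vd n u = N u * \<kappa>6 u - m u * \<kappa>4 u" if "u \<in> J" for u
    using k6[OF that] by (simp add: N_def)
  have n2: "vd (vd n) u = vd N u * \<kappa>6 u + N u * vd \<kappa>6 u - vd m u * \<kappa>4 u - m u * vd \<kappa>4 u"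
    if u: "u \<in> J" for u
    by (rule diff[OF u n1]) (auto intro!: derivative_eq_intros D[OF u] simp: algebra_simps)
  have iter: "(vd ^^ 2) f = vd (vd f)" "(vd ^^ 3) f = vd (vd (vd f))" for f :: "real \<Rightarrow> real"
    by (simp_all add: numeral_2_eq_2 numeral_3_eq_3)
  show ?thesis
    unfolding f1cone_def Let_def iter
    unfolding l0[OF t] l1[OF t] l2[OF t] l3[OF t]
    unfolding m3[OF t] m2[OF t] n2[OF t] n1[OF t] m1[OF t]
    by algebra
qed

end

section \<open>Adapted directors and the striction surface\<close>

lemma sgn_constant_on_connected:
  fixes f :: "real \<Rightarrow> real"
  assumes "connected J" "continuous_on J f" "\<And>t. t \<in> J \<Longrightarrow> f t \<noteq> 0"
  obtains \<sigma> where "\<bar>\<sigma>\<bar> = (1::real)" "\<And>t. t \<in> J \<Longrightarrow> sgn (f t) = \<sigma>"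
proof -
  have conn: "connected (f ` J)"
    using assms(1,2) by (rule connected_continuous_image[rotated])
  show ?thesis
  proof (cases "\<exists>t\<in>J. f t > 0")
    case True
    have "f t > 0" if "t \<in> J" for t
    proof (rule ccontr)
      assume "\<not> f t > 0"
      then have "0 \<in> f ` J"
        using connectedD_interval[OF conn, of "f t"] True that by force
      then show False using assms(3) by auto
    qed
    then show ?thesis using that[of 1] by simp
  next
    case False
    then have "f t < 0" if "t \<in> J" for t using that assms(3)[of t] by force
    then show ?thesis using that[of "-1"] by simp
  qed
qed

lemma in_span_pairD:
  fixes x :: "'a::real_inner"
  assumes "x \<in> span {a, b}" "a \<bullet> a = 1" "b \<bullet> b = 1" "a \<bullet> b = 0"
  shows "x = (x \<bullet> a) *\<^sub>R a + (x \<bullet> b) *\<^sub>R b"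
proof -
  obtain k where "x - k *\<^sub>R a \<in> span {b}" using assms(1) span_breakdown_eq by blast
  then obtain j where "x - k *\<^sub>R a = j *\<^sub>R b" unfolding span_singleton by auto
  then have x: "x = k *\<^sub>R a + j *\<^sub>R b" by (simp add: algebra_simps)
  have "x \<bullet> a = k" "x \<bullet> b = j"
    unfolding x using assms by (simp_all add: inner_simps inner_commute)
  then show ?thesis using x by simp
qed

context frenet_frame
begin

text \<open>Any adapted pair is a rotated or reflected copy of \<open>e3\<close>, \<open>e4\<close>. The four relations that come from
  \<open>|Xh| = |Yh| = 1\<close>, \<open>Xh \<bullet> Yh = 0\<close> and \<open>Xh \<bullet> Yh' = 0\<close> say that the components of \<open>Xh'\<close> and \<open>Yh'\<close> in the
  ruling plane are orthogonal to both \<open>Xh\<close> and \<open>Yh\<close>, hence vanish. So \<open>Xh'\<close> and \<open>Yh'\<close> are multiples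
  of \<open>e2\<close>, the factors being \<open>- \<kappa>4\<close> times the \<open>e3\<close>-components of \<open>Xh\<close> and \<open>Yh\<close>. So \<open>a\<close> is the
  \<open>e3\<close>-component of \<open>Yh\<close> divided by that of \<open>Xh\<close>, and the \<open>e3\<close>-component of \<open>- a Xh + Yh\<close> cancels.\<close>

lemma adapted_directors:
  assumes X: "\<And>t. t \<in> J \<Longrightarrow> X t = e3 t" and Y: "\<And>t. t \<in> J \<Longrightarrow> Y t = e4 t"
    and ad: "constrictively_adapted J X Y Xh Yh"
    and a: "\<And>t. t \<in> J \<Longrightarrow> vd Yh t = a t *\<^sub>R vd Xh t"
  obtains p q g where
    "\<And>t. t \<in> J \<Longrightarrow> p differentiable at t \<and> q differentiable at t"
    "continuous_on J g" "\<And>t. t \<in> J \<Longrightarrow> p t \<noteq> 0 \<and> g t \<noteq> 0"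
    "\<And>t. t \<in> J \<Longrightarrow> Xh t = p t *\<^sub>R e3 t + q t *\<^sub>R e4 t"
    "\<And>t. t \<in> J \<Longrightarrow> vd Xh t = (- p t * \<kappa>4 t) *\<^sub>R e2 t"
    "\<And>t. t \<in> J \<Longrightarrow> - a t *\<^sub>R Xh t + Yh t = g t *\<^sub>R e4 t"
proof -
  define p where "p t = Xh t \<bullet> e3 t" for t
  define q where "q t = Xh t \<bullet> e4 t" for t
  define u where "u t = Yh t \<bullet> e3 t" for t
  define v where "v t = Yh t \<bullet> e4 t" for t
  \<comment> \<open>The determinant of the change of basis from \<open>e3\<close>, \<open>e4\<close> to \<open>Xh\<close>, \<open>Yh\<close>.\<close>
  define D where "D t = p t * v t - q t * u t" for t
  have smXY: "smooth_on J Xh" "smooth_on J Yh"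
    using ad unfolding constrictively_adapted_def by auto
  have diff: "p differentiable at t" "q differentiable at t" "u differentiable at t" "v differentiable at t"
    if t: "t \<in> J" for t
    unfolding p_def[abs_def] q_def[abs_def] u_def[abs_def] v_def[abs_def]
    by (intro differentiable_inner_curves smooth_on_differentiable[OF _ t] smXY frame_smooth smooth_e4)+
  have Xh: "Xh t = p t *\<^sub>R e3 t + q t *\<^sub>R e4 t" and Yh: "Yh t = u t *\<^sub>R e3 t + v t *\<^sub>R e4 t"
    if t: "t \<in> J" for t
  proof -
    have "span {Xh t, Yh t} = span {e3 t, e4 t}"
      using ad t X[OF t] Y[OF t] unfolding constrictively_adapted_def by metis
    then have "Xh t \<in> span {e3 t, e4 t}" "Yh t \<in> span {e3 t, e4 t}"
      by (metis insertI1 insertI2 span_base)+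
    then show "Xh t = p t *\<^sub>R e3 t + q t *\<^sub>R e4 t" "Yh t = u t *\<^sub>R e3 t + v t *\<^sub>R e4 t"
      unfolding p_def q_def u_def v_def using frame_inner[OF t] by (blast intro: in_span_pairD)+
  qed
  have main: "p t * p t + q t * q t = 1" "u t * u t + v t * v t = 1" "p t * u t + q t * v t = 0"
    "D t * D t = 1" "vd Xh t = (- p t * \<kappa>4 t) *\<^sub>R e2 t" "vd Yh t = (- u t * \<kappa>4 t) *\<^sub>R e2 t"
    "p t \<noteq> 0" "u t = a t * p t"
    if t: "t \<in> J" for t
  proof -
    note in_simps = frame_inner[OF t] inner_simps
    have "Xh t \<bullet> Xh t = 1" "Yh t \<bullet> Yh t = 1" "Xh t \<bullet> Yh t = 0"
      using ad t unfolding constrictively_adapted_def by (auto simp: dot_square_norm)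
    then show 1: "p t * p t + q t * q t = 1" "u t * u t + v t * v t = 1" "p t * u t + q t * v t = 0"
      unfolding Xh[OF t] Yh[OF t] by (simp_all add: in_simps mult.commute)
    show D: "D t * D t = 1"
    proof -
      have "D t * D t = (p t * p t + q t * q t) * (u t * u t + v t * v t) - (p t * u t + q t * v t)\<^sup>2"
        unfolding D_def by algebra
      then show ?thesis using 1 by simp
    qed
    define A B A' B' where "A = vd p t - q t * \<kappa>6 t" and "B = vd q t + p t * \<kappa>6 t"
      and "A' = vd u t - v t * \<kappa>6 t" and "B' = vd v t + u t * \<kappa>6 t"
    have Xd: "(Xh has_vector_derivative (- p t * \<kappa>4 t) *\<^sub>R e2 t + A *\<^sub>R e3 t + B *\<^sub>R e4 t) (at t)"
      unfolding A_def B_def by (rule plane_curve_deriv[OF t diff(1,2)[OF t] Xh])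
    have Yd: "(Yh has_vector_derivative (- u t * \<kappa>4 t) *\<^sub>R e2 t + A' *\<^sub>R e3 t + B' *\<^sub>R e4 t) (at t)"
      unfolding A'_def B'_def by (rule plane_curve_deriv[OF t diff(3,4)[OF t] Yh])
    have XX: "Xh s \<bullet> Xh s = 1" "Yh s \<bullet> Yh s = 1" "Xh s \<bullet> Yh s = 0" if "s \<in> J" for s
      using ad that unfolding constrictively_adapted_def by (auto simp: dot_square_norm)
    have XY': "Xh t \<bullet> vd Yh t = 0" "vd Xh t \<noteq> 0"
      using ad t unfolding constrictively_adapted_def by auto
    have "p t * A + q t * B = 0"
      using inner_constant_imp_derivative[OF open_J t XX(1) Xd Xd] unfolding Xh[OF t]
      by (simp add: in_simps) algebra
    moreover have X'Y: "p t * A' + q t * B' = 0"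
      using XY'(1) unfolding vd_eqI[OF Yd] Xh[OF t] by (simp add: in_simps mult.commute)
    moreover have "u t * A + v t * B = 0"
      using inner_constant_imp_derivative[OF open_J t XX(3) Xd Yd] X'Y unfolding Xh[OF t] Yh[OF t]
      by (simp add: in_simps) algebra
    moreover have "u t * A' + v t * B' = 0"
      using inner_constant_imp_derivative[OF open_J t XX(2) Yd Yd] unfolding Yh[OF t]
      by (simp add: in_simps) algebra
    ultimately have "D t * A = 0" "D t * B = 0" "D t * A' = 0" "D t * B' = 0"
      unfolding D_def by algebra+
    moreover have "D t \<noteq> 0" using D by auto
    ultimately have AB: "A = 0" "B = 0" "A' = 0" "B' = 0" by auto
    show Xv: "vd Xh t = (- p t * \<kappa>4 t) *\<^sub>R e2 t" and Yv: "vd Yh t = (- u t * \<kappa>4 t) *\<^sub>R e2 t"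
      using vd_eqI[OF Xd] vd_eqI[OF Yd] AB by simp_all
    show "p t \<noteq> 0" using XY'(2) Xv by auto
    have "vd Yh t \<bullet> e2 t = a t * (vd Xh t \<bullet> e2 t)" using a[OF t] by simp
    then show "u t = a t * p t" unfolding Xv Yv using \<kappa>4_nz[OF t] by (simp add: in_simps)
  qed
  show thesis
  proof (rule that[of p q "\<lambda>t. D t / p t"])
    fix t assume t: "t \<in> J"
    note mt = main[OF t]
    show "p differentiable at t \<and> q differentiable at t" using diff[OF t] by blast
    show "p t \<noteq> 0 \<and> D t / p t \<noteq> 0" using mt(4,7) by auto
    show "Xh t = p t *\<^sub>R e3 t + q t *\<^sub>R e4 t" by (rule Xh[OF t])
    show "vd Xh t = (- p t * \<kappa>4 t) *\<^sub>R e2 t" by (rule mt(5))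
    have "v t - a t * q t = D t / p t" using mt(7,8) by (simp add: D_def field_simps)
    moreover have "- a t *\<^sub>R Xh t + Yh t = (v t - a t * q t) *\<^sub>R e4 t"
      unfolding Xh[OF t] Yh[OF t] using mt(8) by (simp add: algebra_simps)
    ultimately show "- a t *\<^sub>R Xh t + Yh t = (D t / p t) *\<^sub>R e4 t" by simp
  next
    have "continuous_on J p" "continuous_on J q" "continuous_on J u" "continuous_on J v"
      using diff by (meson continuous_at_imp_continuous_on differentiable_imp_continuous_within)+
    then show "continuous_on J (\<lambda>t. D t / p t)"
      unfolding D_def using main(7) by (intro continuous_intros) auto
  qed
qed

text \<open>Only \<open>w\<close>, which moves the base curve along the rulings, and the sign \<open>\<sigma>\<close> depend on the choice of
  the adapted directors. The sign is constant because it is that of a continuous function without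
  zeros on an interval.\<close>

lemma striction_surfaceE:
  assumes "is_striction_surface J S ct Xt"
  obtains w \<sigma> where
    "\<And>t. t \<in> J \<Longrightarrow> w differentiable at t"
    "\<And>t. t \<in> J \<Longrightarrow> ct t = base t + (n t *\<^sub>R e3 t + (n t * w t) *\<^sub>R e4 t)"
    "\<bar>\<sigma>\<bar> = 1" "\<And>t. t \<in> J \<Longrightarrow> Xt t = \<sigma> *\<^sub>R e4 t"
proof -
  obtain c X Y Xh Yh a where tr: "is_two_ruled J S c X Y" and ad: "constrictively_adapted J X Y Xh Yh"
    and a: "\<And>t. t \<in> J \<Longrightarrow> vd Yh t = a t *\<^sub>R vd Xh t"
    and ct: "ct = striction_base c Xh" and Xt: "Xt = striction_director a Xh Yh"
    using assms unfolding is_striction_surface_def by blast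
  \<comment> \<open>Evaluating \<open>S1\<close> at three parameter pairs recovers its base curve and its directors.\<close>
  have S: "c t + s *\<^sub>R X t + r *\<^sub>R Y t = base t + s *\<^sub>R e3 t + r *\<^sub>R e4 t" if "t \<in> J" for t s r
    using tr that unfolding is_two_ruled_def S1_def base_def m_def by simp
  have c: "c t = base t" if "t \<in> J" for t using S[OF that, of 0 0] by simp
  have X: "X t = e3 t" if "t \<in> J" for t using S[OF that, of 1 0] c[OF that] by simp
  have Y: "Y t = e4 t" if "t \<in> J" for t using S[OF that, of 0 1] c[OF that] by simp
  obtain p q g where pq: "\<And>t. t \<in> J \<Longrightarrow> p differentiable at t \<and> q differentiable at t"
    and g: "continuous_on J g" and nz: "\<And>t. t \<in> J \<Longrightarrow> p t \<noteq> 0 \<and> g t \<noteq> 0"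
    and Xh: "\<And>t. t \<in> J \<Longrightarrow> Xh t = p t *\<^sub>R e3 t + q t *\<^sub>R e4 t"
    and Xv: "\<And>t. t \<in> J \<Longrightarrow> vd Xh t = (- p t * \<kappa>4 t) *\<^sub>R e2 t"
    and dir: "\<And>t. t \<in> J \<Longrightarrow> - a t *\<^sub>R Xh t + Yh t = g t *\<^sub>R e4 t"
    using adapted_directors[OF X Y ad a] by metis
  obtain \<sigma> where \<sigma>: "\<bar>\<sigma>\<bar> = (1::real)" "\<And>t. t \<in> J \<Longrightarrow> sgn (g t) = \<sigma>"
    using sgn_constant_on_connected[OF is_interval_connected[OF interval_J] g] nz by metis
  show thesis
  proof (rule that[of "\<lambda>t. q t / p t" \<sigma>])
    fix t assume t: "t \<in> J"
    show "(\<lambda>t. q t / p t) differentiable at t"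
      using pq[OF t] nz[OF t] by (intro differentiable_divide) auto
    have "norm (e4 t) = 1" using frame_inner[OF t] by (simp add: norm_eq_1)
    then show "Xt t = \<sigma> *\<^sub>R e4 t"
      unfolding Xt striction_director_def dir[OF t] \<sigma>(2)[OF t, symmetric]
      by (simp add: sgn_div_norm divide_inverse mult.commute)
    have "vd c t = vd m t *\<^sub>R e2 t + (m t * \<kappa>4 t) *\<^sub>R e3 t"
      using vd_cong_open[OF open_J t c] vd_eqI[OF base_deriv[OF t]] by simp
    then have "(vd c t \<bullet> vd Xh t) / (vd Xh t \<bullet> vd Xh t) = - n t / p t"
      unfolding Xv[OF t] n_def using nz[OF t] \<kappa>4_nz[OF t]
      by (simp add: frame_inner[OF t] inner_simps field_simps)
    then show "ct t = base t + (n t *\<^sub>R e3 t + (n t * (q t / p t)) *\<^sub>R e4 t)"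
      unfolding ct striction_base_def Xh[OF t] c[OF t] using nz[OF t] by (simp add: algebra_simps)
  qed (rule \<sigma>(1))
qed

lemma striction_surface_director_deriv:
  assumes "is_striction_surface J S ct Xt" "t \<in> J"
  shows "vd Xt t = 0 \<longleftrightarrow> \<kappa>6 t = 0"
proof -
  obtain \<sigma> where \<sigma>: "\<bar>\<sigma>\<bar> = 1" "\<And>t. t \<in> J \<Longrightarrow> Xt t = \<sigma> *\<^sub>R e4 t"
    using striction_surfaceE[OF assms(1)] by metis
  have "((\<lambda>t. \<sigma> *\<^sub>R e4 t) has_vector_derivative \<sigma> *\<^sub>R (- \<kappa>6 t *\<^sub>R e3 t)) (at t)"
    using bounded_linear.has_vector_derivative[OF bounded_linear_scaleR_right e4_deriv[OF assms(2)]] .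
  then have "vd Xt t = (- \<sigma> * \<kappa>6 t) *\<^sub>R e3 t"
    using vd_cong_open[OF open_J assms(2) \<sigma>(2)] by (simp add: vd_eqI)
  moreover have "e3 t \<noteq> 0" "\<sigma> \<noteq> 0" using frame_inner[OF assms(2)] \<sigma>(1) by auto
  ultimately show ?thesis by simp
qed

text \<open>The striction curve does not see the free term \<open>w\<close>: the component of \<open>ct'\<close> along \<open>e3\<close> contains
  \<open>- n w \<kappa>6\<close>, so that the correction along \<open>e4\<close> contains \<open>- n w\<close>, which cancels the term in \<open>ct\<close>.\<close>

lemma striction_curve_eq_apex:
  assumes "is_striction_surface J S ct Xt" "t \<in> J" "\<kappa>6 t \<noteq> 0"
  shows "striction_curve ct Xt t = apex t"
proof -
  obtain w \<sigma> where w: "\<And>t. t \<in> J \<Longrightarrow> w differentiable at t"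
    and ct: "\<And>t. t \<in> J \<Longrightarrow> ct t = base t + (n t *\<^sub>R e3 t + (n t * w t) *\<^sub>R e4 t)"
    and \<sigma>: "\<bar>\<sigma>\<bar> = 1" and Xt: "\<And>t. t \<in> J \<Longrightarrow> Xt t = \<sigma> *\<^sub>R e4 t"
    using striction_surfaceE[OF assms(1)] by metis
  have \<sigma>2: "\<sigma> * \<sigma> = 1" using \<sigma> by (metis abs_mult_self_eq mult_1)
  have "((\<lambda>t. \<sigma> *\<^sub>R e4 t) has_vector_derivative \<sigma> *\<^sub>R (- \<kappa>6 t *\<^sub>R e3 t)) (at t)"
    using bounded_linear.has_vector_derivative[OF bounded_linear_scaleR_right e4_deriv[OF assms(2)]] .
  then have Xt': "vd Xt t = (- \<sigma> * \<kappa>6 t) *\<^sub>R e3 t"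
    using vd_cong_open[OF open_J assms(2) Xt] by (simp add: vd_eqI)
  have "((\<lambda>t. n t *\<^sub>R e3 t + (n t * w t) *\<^sub>R e4 t) has_vector_derivative
      (- n t * \<kappa>4 t) *\<^sub>R e2 t + (vd n t - (n t * w t) * \<kappa>6 t) *\<^sub>R e3 t
      + (vd (\<lambda>t. n t * w t) t + n t * \<kappa>6 t) *\<^sub>R e4 t) (at t)"
    by (intro plane_curve_deriv assms(2) smooth_on_differentiable[OF smooth_n] differentiable_mult w refl)
  note vd_eqI[OF has_vector_derivative_add[OF base_deriv[OF assms(2)] this]]
  moreover have "vd ct t = vd (\<lambda>t. base t + (n t *\<^sub>R e3 t + (n t * w t) *\<^sub>R e4 t)) t"
    by (rule vd_cong_open[OF open_J assms(2) ct])
  ultimately have ct': "vd ct t = vd m t *\<^sub>R e2 t + (m t * \<kappa>4 t) *\<^sub>R e3 t +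
      ((- n t * \<kappa>4 t) *\<^sub>R e2 t + (vd n t - (n t * w t) * \<kappa>6 t) *\<^sub>R e3 t
      + (vd (\<lambda>t. n t * w t) t + n t * \<kappa>6 t) *\<^sub>R e4 t)"
    by simp
  have "vd ct t \<bullet> vd Xt t = - \<sigma> * \<kappa>6 t * (m t * \<kappa>4 t + vd n t - n t * w t * \<kappa>6 t)"
    unfolding ct' Xt' by (simp add: frame_inner[OF assms(2)] inner_simps algebra_simps)
  moreover have "vd Xt t \<bullet> vd Xt t = \<kappa>6 t * \<kappa>6 t"
    unfolding Xt' using \<sigma>2 by (simp add: frame_inner[OF assms(2)])
  ultimately have quot: "(vd ct t \<bullet> vd Xt t) / (vd Xt t \<bullet> vd Xt t) = - \<sigma> * (N t - n t * w t)"
    using assms(3) by (simp add: N_def field_simps)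
  have "(- \<sigma> * x) *\<^sub>R \<sigma> *\<^sub>R e4 t = (- (\<sigma> * \<sigma>) * x) *\<^sub>R e4 t" for x
    by simp
  then have "(- \<sigma> * x) *\<^sub>R \<sigma> *\<^sub>R e4 t = - x *\<^sub>R e4 t" for x
    unfolding \<sigma>2 by simp
  then show ?thesis
    unfolding striction_curve_def apex_def quot ct[OF assms(2)] Xt[OF assms(2)]
    by (simp only:) (simp add: algebra_simps)
qed

text \<open>The components along \<open>e2\<close> and \<open>e3\<close> vanish by the very choice of \<open>n\<close> and \<open>N\<close>.\<close>

lemma apex_deriv:
  assumes k6: "\<And>t. t \<in> J \<Longrightarrow> \<kappa>6 t \<noteq> 0" and t: "t \<in> J"
  shows "(apex has_vector_derivative (n t * \<kappa>6 t + vd N t) *\<^sub>R e4 t) (at t)"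
proof -
  have eq: "vd m t = n t * \<kappa>4 t" "vd n t = N t * \<kappa>6 t - m t * \<kappa>4 t"
    using \<kappa>4_nz[OF t] k6[OF t] by (simp_all add: n_def N_def)
  have "((\<lambda>t. n t *\<^sub>R e3 t + N t *\<^sub>R e4 t) has_vector_derivative
      (- n t * \<kappa>4 t) *\<^sub>R e2 t + (vd n t - N t * \<kappa>6 t) *\<^sub>R e3 t + (vd N t + n t * \<kappa>6 t) *\<^sub>R e4 t) (at t)"
    by (intro plane_curve_deriv t smooth_on_differentiable[OF smooth_n] smooth_on_differentiable[OF smooth_N] k6 refl)
  from has_vector_derivative_add[OF base_deriv[OF t] this]
  have "(apex has_vector_derivative vd m t *\<^sub>R e2 t + (m t * \<kappa>4 t) *\<^sub>R e3 t +
     ((- n t * \<kappa>4 t) *\<^sub>R e2 t + (vd n t - N t * \<kappa>6 t) *\<^sub>R e3 t + (vd N t + n t * \<kappa>6 t) *\<^sub>R e4 t)) (at t)"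
    unfolding apex_def[abs_def] by (simp add: add.assoc)
  then show ?thesis
    by (rule has_vector_derivative_eq_rhs) (simp add: eq algebra_simps)
qed

lemma apex_constant_iff:
  assumes k6: "\<And>t. t \<in> J \<Longrightarrow> \<kappa>6 t \<noteq> 0"
  shows "(\<exists>P. \<forall>t\<in>J. apex t = P) \<longleftrightarrow> (\<forall>t\<in>J. f1cone l \<kappa>1 \<kappa>4 \<kappa>6 t = 0)"
proof -
  have "f1cone l \<kappa>1 \<kappa>4 \<kappa>6 t = 0 \<longleftrightarrow> n t * \<kappa>6 t + vd N t = 0" if "t \<in> J" for t
    using f1cone_eq[OF that k6] \<kappa>1_nz[OF that] \<kappa>4_nz[OF that] k6[OF that] by simp
  moreover have "(\<exists>P. \<forall>t\<in>J. apex t = P) \<longleftrightarrow> (\<forall>t\<in>J. n t * \<kappa>6 t + vd N t = 0)"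
  proof
    assume "\<exists>P. \<forall>t\<in>J. apex t = P"
    then obtain P where P: "\<And>t. t \<in> J \<Longrightarrow> apex t = P" by blast
    show "\<forall>t\<in>J. n t * \<kappa>6 t + vd N t = 0"
    proof
      fix t assume t: "t \<in> J"
      have "vd apex t = vd (\<lambda>_. P) t" by (rule vd_cong_open[OF open_J t P])
      also have "\<dots> = 0" by (rule vd_eqI) simp
      finally have "(n t * \<kappa>6 t + vd N t) *\<^sub>R e4 t = 0" using vd_eqI[OF apex_deriv[OF k6 t]] by simp
      then show "n t * \<kappa>6 t + vd N t = 0" using frame_inner(16)[OF t] by auto
    qed
  next
    assume z: "\<forall>t\<in>J. n t * \<kappa>6 t + vd N t = 0"
    have "(apex has_vector_derivative 0) (at t within J)" if "t \<in> J" for t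
      using apex_deriv[OF k6 that] z that by (simp add: has_vector_derivative_at_within)
    then show "\<exists>P. \<forall>t\<in>J. apex t = P"
      using has_vector_derivative_zero_constant[OF is_interval_convex[OF interval_J]] by metis
  qed
  ultimately show ?thesis by simp
qed

lemma pseudo_nondegenerate_ruling: "pseudo_nondegenerate J e3 e4"
  unfolding pseudo_nondegenerate_def
proof
  fix t assume t: "t \<in> J"
  note o = frame_inner[OF t]
  let ?V = "{e3 t, e4 t, vd e3 t, vd e4 t}" and ?W = "{e2 t, e3 t, e4 t}"
  have d: "vd e3 t = - \<kappa>4 t *\<^sub>R e2 t + \<kappa>6 t *\<^sub>R e4 t" "vd e4 t = - \<kappa>6 t *\<^sub>R e3 t"
    using vd_eqI[OF e3_deriv[OF t]] vd_eqI[OF e4_deriv[OF t]] by auto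
  have "x *\<^sub>R e2 t + y *\<^sub>R e4 t \<in> span ?W" "x *\<^sub>R e3 t \<in> span ?W" for x y
    by (intro span_add span_scale span_base; simp)+
  then have "vd e3 t \<in> span ?W" "vd e4 t \<in> span ?W"
    unfolding d by blast+
  then have "?V \<subseteq> span ?W"
    by (simp add: span_base)
  moreover have "?W \<subseteq> span ?V"
  proof -
    have "e2 t = (- 1 / \<kappa>4 t) *\<^sub>R (vd e3 t - \<kappa>6 t *\<^sub>R e4 t)"
      unfolding d using \<kappa>4_nz[OF t] by simp
    moreover have "(- 1 / \<kappa>4 t) *\<^sub>R (vd e3 t - \<kappa>6 t *\<^sub>R e4 t) \<in> span ?V"
      by (intro span_scale span_diff span_base) auto
    ultimately show ?thesis by (auto intro: span_base)
  qed
  ultimately have "span ?V = span ?W" by (simp add: span_eq)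
  moreover have "independent ?W"
    using o by (intro pairwise_orthogonal_independent) (auto simp: pairwise_def orthogonal_def)
  moreover have "card ?W = 3"
  proof -
    have "e2 t \<noteq> e3 t" "e2 t \<noteq> e4 t" "e3 t \<noteq> e4 t" using o by (metis zero_neq_one)+
    then show ?thesis by simp
  qed
  ultimately show "dim (span ?V) = 3" by (metis dim_span_eq_card_independent)
qed

text \<open>Rotating \<open>e3\<close>, \<open>e4\<close> against the torsion \<open>\<kappa>6\<close> gives adapted directors as long as \<open>cos \<theta>\<close> has no
  zero, that is, as long as \<open>Xh' = - cos \<theta> \<kappa>4 e2\<close> does not vanish.\<close>

lemma striction_surface_exists:
  assumes \<theta>: "\<And>t. t \<in> J \<Longrightarrow> (\<theta> has_vector_derivative \<kappa>6 t) (at t)"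
    and nz: "\<And>t. t \<in> J \<Longrightarrow> cos (\<theta> t) \<noteq> 0"
  shows "\<exists>ct Xt. is_striction_surface J S ct Xt"
proof -
  define p where "p t = cos (\<theta> t)" for t
  define q where "q t = - sin (\<theta> t)" for t
  define Xh where "Xh t = p t *\<^sub>R e3 t + q t *\<^sub>R e4 t" for t
  define Yh where "Yh t = - q t *\<^sub>R e3 t + p t *\<^sub>R e4 t" for t
  have p: "(p has_vector_derivative \<kappa>6 t * q t) (at t)" and q: "(q has_vector_derivative - (\<kappa>6 t * p t)) (at t)"
    if "t \<in> J" for t
    using \<theta>[OF that] unfolding p_def[abs_def] q_def[abs_def] has_real_derivative_iff_has_vector_derivative[symmetric]
    by (auto intro!: derivative_eq_intros)
  have pq: "p t * p t + q t * q t = 1" for t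
    unfolding p_def q_def using sin_cos_squared_add[of "\<theta> t"] by (simp add: power2_eq_square)
  have sm: "smooth_on J p" "smooth_on J q"
    using smooth_on_rotation_ode[OF open_J frame_smooth(7) p q] by auto
  have q': "((\<lambda>t. - q t) has_vector_derivative \<kappa>6 t * p t) (at t)" if "t \<in> J" for t
    using has_vector_derivative_minus[OF q[OF that]] by simp
  have smXY: "smooth_on J Xh" "smooth_on J Yh"
    unfolding Xh_def[abs_def] Yh_def[abs_def]
    by (intro smooth_on_add smooth_on_scaleR smooth_on_minus open_J sm frame_smooth smooth_e4)+
  have Xv: "vd Xh t = (- p t * \<kappa>4 t) *\<^sub>R e2 t" if t: "t \<in> J" for t
    using vd_eqI[OF plane_curve_deriv[OF t differentiableI_vector[OF p[OF t]] differentiableI_vector[OF q[OF t]] Xh_def]]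
      vd_eqI[OF p[OF t]] vd_eqI[OF q[OF t]] by simp
  have Yv: "vd Yh t = (q t * \<kappa>4 t) *\<^sub>R e2 t" if t: "t \<in> J" for t
    using vd_eqI[OF plane_curve_deriv[OF t differentiableI_vector[OF q'[OF t]] differentiableI_vector[OF p[OF t]] Yh_def]]
      vd_eqI[OF p[OF t]] vd_eqI[OF q'[OF t]] by simp
  have tr: "is_two_ruled J S base e3 e4"
    unfolding is_two_ruled_def using smooth_base frame_smooth smooth_e4 by (auto simp: S1_def base_def m_def)
  have ad: "constrictively_adapted J e3 e4 Xh Yh"
    unfolding constrictively_adapted_def
  proof (intro conjI ballI smXY)
    fix t assume t: "t \<in> J"
    note o = frame_inner[OF t] inner_simps
    have "Xh t \<in> span {e3 t, e4 t}" "Yh t \<in> span {e3 t, e4 t}"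
      unfolding Xh_def Yh_def by (intro span_add span_scale span_base; simp)+
    moreover have "e3 t \<in> span {Xh t, Yh t}" "e4 t \<in> span {Xh t, Yh t}"
    proof -
      have "p t *\<^sub>R Xh t + (- q t) *\<^sub>R Yh t = (p t * p t + q t * q t) *\<^sub>R e3 t"
        "q t *\<^sub>R Xh t + p t *\<^sub>R Yh t = (p t * p t + q t * q t) *\<^sub>R e4 t"
        unfolding Xh_def Yh_def by (simp_all add: algebra_simps)
      then have "e3 t = p t *\<^sub>R Xh t + (- q t) *\<^sub>R Yh t" "e4 t = q t *\<^sub>R Xh t + p t *\<^sub>R Yh t"
        unfolding pq by simp_all
      moreover have "x *\<^sub>R Xh t + y *\<^sub>R Yh t \<in> span {Xh t, Yh t}" for x y
        by (intro span_add span_scale span_base; simp)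
      ultimately show "e3 t \<in> span {Xh t, Yh t}" "e4 t \<in> span {Xh t, Yh t}" by metis+
    qed
    ultimately show "span {Xh t, Yh t} = span {e3 t, e4 t}" by (simp add: span_eq)
    show "norm (Xh t) = 1" "norm (Yh t) = 1" "Xh t \<bullet> Yh t = 0"
      unfolding norm_eq_1 Xh_def Yh_def using pq[of t] by (simp_all add: o algebra_simps)
    show "Xh t \<bullet> vd Yh t = 0" unfolding Yv[OF t] Xh_def by (simp add: o)
    show "vd Xh t \<noteq> 0"
      unfolding Xv[OF t] using nz[OF t] \<kappa>4_nz[OF t] o(6) by (auto simp: p_def)
  qed
  have a: "\<forall>t\<in>J. vd Yh t = (- q t / p t) *\<^sub>R vd Xh t"
    using Xv Yv nz by (simp add: p_def)
  have "is_striction_surface J S (striction_base base Xh) (striction_director (\<lambda>t. - q t / p t) Xh Yh)"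
    unfolding is_striction_surface_def
    by (intro exI conjI) (rule tr pseudo_nondegenerate_ruling ad a refl)+
  then show ?thesis by blast
qed

text \<open>Both types ask for some striction surface with a property that, by the lemmas above, does not
  depend on the surface chosen; so only existence is left as a hypothesis.\<close>

lemma cylinder_cone_type_iff:
  assumes ex: "\<exists>ct Xt. is_striction_surface J S ct Xt"
  shows "cylinder_type J S \<longleftrightarrow> (\<forall>t\<in>J. \<kappa>6 t = 0)"
    and "(\<And>t. t \<in> J \<Longrightarrow> \<kappa>6 t \<noteq> 0) \<Longrightarrow> cone_type J S \<longleftrightarrow> (\<forall>t\<in>J. f1cone l \<kappa>1 \<kappa>4 \<kappa>6 t = 0)"
proof -
  show "cylinder_type J S \<longleftrightarrow> (\<forall>t\<in>J. \<kappa>6 t = 0)"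
    unfolding cylinder_type_def is_cylinder_def using striction_surface_director_deriv ex by metis
  assume k6: "\<And>t. t \<in> J \<Longrightarrow> \<kappa>6 t \<noteq> 0"
  have "is_cone J ct Xt \<longleftrightarrow> (\<exists>P. \<forall>t\<in>J. apex t = P)" if "is_striction_surface J S ct Xt" for ct Xt
    unfolding is_cone_def non_cylindrical_def
    using striction_surface_director_deriv[OF that] striction_curve_eq_apex[OF that] k6 by simp
  then show "cone_type J S \<longleftrightarrow> (\<forall>t\<in>J. f1cone l \<kappa>1 \<kappa>4 \<kappa>6 t = 0)"
    unfolding cone_type_def using apex_constant_iff k6 ex by metis
qed

end

section \<open>Cylinder type and cone type\<close>

text \<open>This determines the size of the interval in the theorem: the angle starts at \<open>0\<close>, where the cosine
  is \<open>1\<close>, and the cosine stays positive for a while.\<close>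

lemma local_angle:
  fixes k :: "real \<Rightarrow> real"
  assumes I: "open I" "0 \<in> I" and k: "continuous_on I k"
  obtains d \<theta> where "d > 0" "\<And>t. t \<in> {-d<..<d} \<Longrightarrow> (\<theta> has_vector_derivative k t) (at t)"
    "\<And>t. t \<in> {-d<..<d} \<Longrightarrow> cos (\<theta> t) \<noteq> 0"
proof -
  obtain e where e: "e > 0" "cball 0 e \<subseteq> I" using I open_contains_cball by blast
  then have "{-e..e} \<subseteq> I" by (simp add: cball_eq_atLeastAtMost)
  then have cont: "continuous_on {-e..e} k" using k continuous_on_subset by blast
  define G where "G t = integral {-e..t} k" for t
  have G: "(G has_vector_derivative k x) (at x within {-e..e})" if "x \<in> {-e..e}" for x
    unfolding G_def[abs_def] by (rule integral_has_vector_derivative[OF cont that])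
  define \<theta> where "\<theta> t = G t - G 0" for t
  have \<theta>: "(\<theta> has_vector_derivative k t) (at t)" if "t \<in> {-e<..<e}" for t
  proof -
    have "(G has_vector_derivative k t) (at t within {-e<..<e})"
      by (rule has_vector_derivative_within_subset[OF G]) (use that in auto)
    then have "(G has_vector_derivative k t) (at t)"
      using has_vector_derivative_within_open[OF that, of G "k t"] by simp
    then show ?thesis unfolding \<theta>_def[abs_def] by (simp add: has_vector_derivative_diff_const)
  qed
  have "isCont (\<lambda>t. cos (\<theta> t)) 0"
    using has_vector_derivative_continuous[OF \<theta>[of 0]] e(1) by (intro continuous_intros) auto
  moreover have "cos (\<theta> 0) > 0" by (simp add: \<theta>_def)
  ultimately have "eventually (\<lambda>t. cos (\<theta> t) > 0) (at 0)"
    unfolding isCont_def by (rule order_tendstoD(1))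
  then obtain d where d: "d > 0" "\<And>t. t \<noteq> 0 \<Longrightarrow> dist t 0 < d \<Longrightarrow> cos (\<theta> t) > 0"
    unfolding eventually_at by auto
  show thesis
  proof (rule that[of "min d e" \<theta>])
    fix t assume t: "t \<in> {- min d e<..<min d e}"
    show "(\<theta> has_vector_derivative k t) (at t)" using t by (intro \<theta>) auto
    show "cos (\<theta> t) \<noteq> 0"
    proof (cases "t = 0")
      case False
      have "dist t 0 < d" using t unfolding dist_real_def by auto
      then show ?thesis using d(2)[OF False] by simp
    qed (use \<open>cos (\<theta> 0) > 0\<close> in simp)
  qed (use d e in auto)
qed

theorem theorem4p1:
  fixes \<gamma> e1 e2 e3 e4 :: "real \<Rightarrow> real^4"
    and l \<kappa>1 \<kappa>4 \<kappa>6 :: "real \<Rightarrow> real"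
    and I :: "real set"
  assumes "open I" and "is_interval I" and "0 \<in> I"
    and "smooth_on I \<gamma>" and "\<gamma> 0 = 0"
    and "pseudo_finite_osculation_type \<gamma>"
    and "frenet_type_frame I \<gamma> e1 e2 e3 e4 l \<kappa>1 \<kappa>4 \<kappa>6"
    and "\<forall>t\<in>I. \<kappa>1 t * \<kappa>4 t \<noteq> 0"
  shows "\<exists>d>0. \<forall>J. open J \<and> is_interval J \<and> 0 \<in> J \<and> J \<subseteq> I \<inter> {-d<..<d} \<longrightarrow>
      (cylinder_type J (S1 \<gamma> e2 e3 e4 l \<kappa>1) \<longleftrightarrow> (\<forall>t\<in>J. \<kappa>6 t = 0)) \<and>
      ((\<forall>t\<in>J. \<kappa>6 t \<noteq> 0) \<longrightarrow>
        (cone_type J (S1 \<gamma> e2 e3 e4 l \<kappa>1) \<longleftrightarrow> (\<forall>t\<in>J. f1cone l \<kappa>1 \<kappa>4 \<kappa>6 t = 0)))"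
proof -
  have "smooth_on I \<kappa>6" using assms(7) unfolding frenet_type_frame_def by blast
  then have "continuous_on I \<kappa>6"
    by (meson continuous_at_imp_continuous_on has_vector_derivative_continuous smooth_on_has_vd)
  then obtain d \<theta> where d: "d > 0"
    and \<theta>: "\<And>t. t \<in> {-d<..<d} \<Longrightarrow> (\<theta> has_vector_derivative \<kappa>6 t) (at t)"
      "\<And>t. t \<in> {-d<..<d} \<Longrightarrow> cos (\<theta> t) \<noteq> 0"
    using local_angle[OF assms(1,3)] by metis
  show ?thesis
  proof (intro exI[of _ d] conjI d allI impI)
    fix J assume J: "open J \<and> is_interval J \<and> 0 \<in> J \<and> J \<subseteq> I \<inter> {-d<..<d}"
    interpret frenet_frame J \<gamma> e1 e2 e3 e4 l \<kappa>1 \<kappa>4 \<kappa>6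
    proof
      show "frenet_type_frame J \<gamma> e1 e2 e3 e4 l \<kappa>1 \<kappa>4 \<kappa>6"
        using assms(7) J unfolding frenet_type_frame_def by (auto intro: smooth_on_subset)
    qed (use J assms smooth_on_subset in auto)
    have ex: "\<exists>ct Xt. is_striction_surface J (S1 \<gamma> e2 e3 e4 l \<kappa>1) ct Xt"
    proof (rule striction_surface_exists)
      fix t assume "t \<in> J"
      then have "t \<in> {-d<..<d}" using J by blast
      then show "(\<theta> has_vector_derivative \<kappa>6 t) (at t)" "cos (\<theta> t) \<noteq> 0" by (fact \<theta>)+
    qed
    show "cylinder_type J (S1 \<gamma> e2 e3 e4 l \<kappa>1) \<longleftrightarrow> (\<forall>t\<in>J. \<kappa>6 t = 0)"
      by (rule cylinder_cone_type_iff(1)[OF ex])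
    show "cone_type J (S1 \<gamma> e2 e3 e4 l \<kappa>1) \<longleftrightarrow> (\<forall>t\<in>J. f1cone l \<kappa>1 \<kappa>4 \<kappa>6 t = 0)" if "\<forall>t\<in>J. \<kappa>6 t \<noteq> 0"
      using that by (intro cylinder_cone_type_iff(2)[OF ex]) auto
  qed
qed

end
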